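(* Let $n\in\mathbb{N}$, $\alpha\in[-1/2,1)$, $\zeta\in\mathbb{C}$ with $|\zeta|\le \frac{1}{2n-1}$, and let $f=h+\overline{g}\in\mathcal{M}(\alpha,\zeta,n)$. Then $$|T_{2}(n)[h]|\leq\left(\frac{1}{n!}\prod_{j=2}^{n}(j-2\alpha)\right)^2+\left(\frac{1}{(n+1)!}\prod_{j=2}^{n+1}(j-2\alpha)\right)^2\quad (n\in \mathbb{N}\setminus\{1\}),$$ and $$|T_{2}(n)[g]|\leq \frac{1}{[(2n-1)(n+1)]^2}.$$ Both inequalities are sharp: equality is attained by functions of the form $$f(z)=\int_0^z\frac{dt}{(1-\delta t)^{2-2\alpha}}+\overline{\int_0^z\frac{\zeta t^n}{(1-\delta t)^{2-2\alpha}}\,dt}\quad(z\in\mathbb{D}),$$ for suitable $\delta$ with $|\delta|=1$ and suitable $\zeta$ with $|\zeta|\le\frac1{2n-1}$.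
   Context: $\mathbb{D}=\{z\in\mathbb{C}:|z|<1\}$ and $\mathbb{N}=\{1,2,3,\dots\}$. $\mathcal{H}$ is the class of sense-preserving harmonic mappings $f=h+\overline{g}$ in $\mathbb{D}$ (i.e. $|h'|>|g'|$ in $\mathbb{D}$), where $h(z)=z+\sum_{k=2}^\infty a_kz^k$ and $g(z)=\sum_{k=1}^\infty b_kz^k$ are analytic in $\mathbb{D}$; put $a_1=1$. For $-1/2\le\alpha<1$, $\mathcal{K}(\alpha)$ is the class of analytic functions $h$ in $\mathbb{D}$ with $h(0)=h'(0)-1=0$ and $\operatorname{Re}\left(1+\frac{zh''(z)}{h'(z)}\right)>\alpha$ for $z\in\mathbb{D}$. For $n\in\mathbb{N}$, $\alpha\in[-1/2,1)$ and $\zeta\in\mathbb{C}$ with $|\zeta|\le\frac1{2n-1}$, $\mathcal{M}(\alpha,\zeta,n)$ is the class of $f=h+\overline{g}\in\mathcal{H}$ such that $h\in\mathcal{K}(\alpha)$ and $g'(z)=\zeta z^nh'(z)$ in $\mathbb{D}$. For an analytic function $F(z)=\sum_{k\ge1}c_kz^k$, the symmetric Toeplitz determinant $T_q(n)[F]$ ($q,n\in\mathbb{N}$) is the determinant of the $q\times q$ matrix whose $(i,j)$ entry is $c_{n+|i-j|}$. In particular $T_2(n)[F]=c_n^2-c_{n+1}^2$. Thus $T_q(n)[h]$ is formed with the $a_k$ and $T_q(n)[g]$ with the $b_k$. *)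

theory Defs
  imports "HOL-Complex_Analysis.Complex_Analysis" "Jordan_Normal_Form.Determinant"
begin

definition canonical_rep ::
    "(complex \<Rightarrow> complex) \<Rightarrow> (complex \<Rightarrow> complex) \<Rightarrow> (complex \<Rightarrow> complex) \<Rightarrow> bool" where
  "canonical_rep f h g \<longleftrightarrow>
     h holomorphic_on ball 0 1 \<and> g holomorphic_on ball 0 1 \<and> g 0 = 0 \<and>
     (\<forall>z\<in>ball 0 1. f z = h z + cnj (g z))"

definition class_H :: "(complex \<Rightarrow> complex) set" where
  "class_H = {f. \<exists>h g. canonical_rep f h g \<and> h 0 = 0 \<and> deriv h 0 = 1 \<and>
                 (\<forall>z\<in>ball 0 1. cmod (deriv g z) < cmod (deriv h z))}"

(* The conjunct deriv h z ~= 0 is the well-definedness of the quotient h''/h', which would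
   otherwise take the value 0 at a zero of h'. *)
definition class_K :: "real \<Rightarrow> (complex \<Rightarrow> complex) set" where
  "class_K \<alpha> = {h. h holomorphic_on ball 0 1 \<and> h 0 = 0 \<and> deriv h 0 = 1 \<and>
                 (\<forall>z\<in>ball 0 1. deriv h z \<noteq> 0 \<and>
                    Re (1 + z * deriv (deriv h) z / deriv h z) > \<alpha>)}"

definition class_M :: "real \<Rightarrow> complex \<Rightarrow> nat \<Rightarrow> (complex \<Rightarrow> complex) set" where
  "class_M \<alpha> \<zeta> n = {f \<in> class_H. \<exists>h g. canonical_rep f h g \<and> h \<in> class_K \<alpha> \<and>
                      (\<forall>z\<in>ball 0 1. deriv g z = \<zeta> * z ^ n * deriv h z)}"

(* Matrix indices run over 0..<q here; the entries depend only on the difference of the indices. *)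
definition sym_toeplitz_det :: "nat \<Rightarrow> nat \<Rightarrow> (complex \<Rightarrow> complex) \<Rightarrow> complex" where
  "sym_toeplitz_det q n F =
     Determinant.det (Matrix.mat q q
       (\<lambda>(i, j). fps_nth (fps_expansion F 0) (n + nat \<bar>int i - int j\<bar>)))"

lemma sym_toeplitz_det_2:
  "sym_toeplitz_det 2 n F =
     (fps_nth (fps_expansion F 0) n)\<^sup>2 - (fps_nth (fps_expansion F 0) (n + 1))\<^sup>2"
proof -
  let ?A = "Matrix.mat 2 2
       (\<lambda>(i, j). fps_nth (fps_expansion F 0) (n + nat \<bar>int i - int j\<bar>))"
  have "Determinant.det ?A = (\<Sum>j<2. ?A $$ (0, j) * cofactor ?A 0 j)"
    by (rule laplace_expansion_row) auto
  also have "\<dots> = ?A $$ (0, 0) * ?A $$ (1, 1) - ?A $$ (0, 1) * ?A $$ (1, 0)"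
    by (simp add: numeral_2_eq_2 cofactor_def mat_delete_def det_single)
  finally show ?thesis
    by (simp add: sym_toeplitz_det_def power2_eq_square)
qed

(* For |delta| = 1 and |t| < 1 we have Re (1 - delta * t) > 0, so the principal branch of powr is
   the analytic branch with value 1 at t = 0. *)
definition extremal_map :: "real \<Rightarrow> complex \<Rightarrow> complex \<Rightarrow> nat \<Rightarrow> complex \<Rightarrow> complex" where
  "extremal_map \<alpha> \<delta> \<zeta> n z =
     contour_integral (linepath 0 z)
       (\<lambda>t. 1 / (1 - \<delta> * t) powr complex_of_real (2 - 2 * \<alpha>)) +
     cnj (contour_integral (linepath 0 z)
       (\<lambda>t. \<zeta> * t ^ n / (1 - \<delta> * t) powr complex_of_real (2 - 2 * \<alpha>)))"

end

theory Submission
  imports Defs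
begin

text \<open>
  Write \<open>f = h + cnj g\<close> with \<open>h = \<Sum> a\<^sub>k z\<^sup>k\<close> and \<open>g = \<Sum> b\<^sub>k z\<^sup>k\<close>. The bound for \<open>h\<close> is
  \<open>\<bar>a\<^sub>n\<^sup>2 - a\<^sub>n\<^sub>+\<^sub>1\<^sup>2\<bar> \<le> \<bar>a\<^sub>n\<bar>\<^sup>2 + \<bar>a\<^sub>n\<^sub>+\<^sub>1\<bar>\<^sup>2\<close> combined with the sharp coefficient estimate for
  \<open>class_K \<alpha>\<close> (lemma \<open>class_K_coeff_bound\<close>). The latter follows by induction from
  Caratheodory's inequality \<open>\<bar>p\<^sub>k\<bar> \<le> 2\<close> for \<open>p = 1 + \<Sum> p\<^sub>k z\<^sup>k\<close> of positive real part
  (lemma \<open>caratheodory_coeff_bound\<close>), applied to \<open>p = (1 + z h'' / h' - \<alpha>) / (1 - \<alpha>)\<close>.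

  The relation \<open>g' = \<zeta> z\<^sup>n h'\<close> forces \<open>b\<^sub>n = 0\<close> and \<open>b\<^sub>n\<^sub>+\<^sub>1 = \<zeta> / (n + 1)\<close>, so the
  determinant of \<open>g\<close> has modulus exactly \<open>(\<bar>\<zeta>\<bar> / (n + 1))\<^sup>2\<close>, which is largest for \<open>\<bar>\<zeta>\<bar> = 1 / (2n - 1)\<close>.

  For the extremal maps \<open>a\<^sub>k\<close> is \<open>\<delta>\<^sup>k\<^sup>-\<^sup>1\<close> times the bound for \<open>\<bar>a\<^sub>k\<bar>\<close>; with \<open>\<delta> = \<i>\<close> the squares
  \<open>a\<^sub>n\<^sup>2\<close> and \<open>a\<^sub>n\<^sub>+\<^sub>1\<^sup>2\<close> point in opposite directions and the triangle inequality becomes an equality. Since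
  \<open>class_M\<close> and the determinants refer to separately chosen decompositions of \<open>f\<close>, uniqueness of
  this decomposition (lemma \<open>canonical_rep_unique\<close>) is needed to identify them.
\<close>

section \<open>Power series on the unit disc\<close>

lemma fps_expansion_ball:
  assumes "f holomorphic_on ball 0 1"
  shows "f has_fps_expansion fps_expansion f 0"
  using assms by (intro has_fps_expansion_fps_expansion[of "ball 0 1"]) auto

lemma has_fps_expansion_eq_on_ball:
  fixes f g :: "complex \<Rightarrow> complex"
  assumes "f has_fps_expansion F" "g has_fps_expansion G"
    and "\<And>z. z \<in> ball 0 1 \<Longrightarrow> f z = g z"
  shows "F = G"
proof -
  have "eventually (\<lambda>z. z \<in> ball 0 (1::real)) (nhds (0::complex))"
    by (intro eventually_nhds_in_open) auto
  then have "eventually (\<lambda>z. f z = g z) (nhds 0)"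
    by eventually_elim (rule assms(3))
  then have "f has_fps_expansion G"
    using assms(2) by (subst has_fps_expansion_cong) auto
  with assms(1) show ?thesis
    by (rule fps_expansion_unique_complex)
qed

lemma fps_expansion_eq_on_ball:
  assumes "\<And>z. z \<in> ball 0 1 \<Longrightarrow> f z = g z"
  shows "fps_expansion f 0 = fps_expansion g 0"
proof (rule fps_expansion_cong)
  have "eventually (\<lambda>z. z \<in> ball 0 (1::real)) (nhds (0::complex))"
    by (intro eventually_nhds_in_open) auto
  then show "eventually (\<lambda>z. f z = g z) (nhds 0)"
    by eventually_elim (rule assms)
qed

section \<open>Coefficients of functions with positive real part\<close>

lemma fps_coeff_bound_of_bounded:
  assumes hol: "f holomorphic_on ball 0 1" and bd: "\<And>z. z \<in> ball 0 1 \<Longrightarrow> cmod (f z) \<le> 1"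
  shows "cmod (fps_nth (fps_expansion f 0) k) \<le> 1"
proof -
  let ?c = "cmod (fps_nth (fps_expansion f 0) k)"
  have "?c * r ^ k \<le> 1" if r: "0 < r" "r < 1" for r :: real
  proof -
    have "cmod ((deriv ^^ k) f 0) \<le> fact k * 1 / r ^ k"
    proof (rule Cauchy_inequality)
      show "f holomorphic_on ball 0 r" "continuous_on (cball 0 r) f"
        using r
        by (auto intro!: holomorphic_on_imp_continuous_on intro: holomorphic_on_subset[OF hol])
      show "cmod (f x) \<le> 1" if "cmod (0 - x) = r" for x
        using that r by (intro bd) simp
    qed (use r in auto)
    then show ?thesis
      using r by (simp add: fps_expansion_def norm_divide field_simps)
  qed
  then have "eventually (\<lambda>r. ?c * r ^ k \<le> 1) (at_left 1)"
    by (auto simp: eventually_at_left_field intro!: exI[of _ 0])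
  moreover have "((\<lambda>r::real. ?c * r ^ k) \<longlongrightarrow> ?c * 1 ^ k) (at_left 1)"
    by (intro tendsto_intros)
  ultimately show ?thesis
    using tendsto_upperbound[of _ "?c * 1 ^ k" "at_left (1::real)" 1] by simp
qed

text \<open>
  If \<open>q = 1 + q\<^sub>k z\<^sup>k + \<dots>\<close> has positive real part, then its Cayley transform
  \<open>w = (q - 1) / (q + 1)\<close> is bounded by 1, and comparing the coefficients of \<open>z\<^sup>k\<close> in
  \<open>q - 1 = w (q + 1)\<close> gives \<open>q\<^sub>k = 2 w\<^sub>k\<close>.
\<close>

lemma caratheodory_first_coeff:
  assumes hol: "q holomorphic_on ball 0 1" and q0: "q 0 = 1"
    and pos: "\<And>z. z \<in> ball 0 1 \<Longrightarrow> Re (q z) > 0"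
    and Q: "q has_fps_expansion Q"
    and van: "\<And>m. 0 < m \<Longrightarrow> m < k \<Longrightarrow> fps_nth Q m = 0" and k: "0 < k"
  shows "cmod (fps_nth Q k) \<le> 2"
proof -
  define w where "w z = (q z - 1) / (q z + 1)" for z
  have nz: "q z + 1 \<noteq> 0" if "z \<in> ball 0 1" for z
    using pos[OF that] by (auto simp: complex_eq_iff)
  have holw: "w holomorphic_on ball 0 1"
    unfolding w_def using nz by (intro holomorphic_intros hol) auto
  have "cmod (w z) \<le> 1" if "z \<in> ball 0 1" for z
  proof -
    have "cmod (q z - 1) \<le> cmod (q z + 1)"
      using pos[OF that] by (simp add: cmod_def power2_eq_square algebra_simps)
    then show ?thesis using nz[OF that] by (simp add: w_def norm_divide)
  qed
  note W1 = fps_coeff_bound_of_bounded[OF holw this, of k]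
  define W where "W = fps_expansion w 0"
  have Wexp: "w has_fps_expansion W"
    unfolding W_def by (rule fps_expansion_ball[OF holw])
  have eq: "Q - 1 = W * (Q + 1)"
  proof (rule has_fps_expansion_eq_on_ball)
    show "(\<lambda>z. q z - 1) has_fps_expansion Q - 1"
      "(\<lambda>z. w z * (q z + 1)) has_fps_expansion W * (Q + 1)"
      by (intro fps_expansion_intros Wexp Q)+
  qed (use nz in \<open>simp add: w_def\<close>)
  have Q0: "fps_nth Q 0 = 1"
    using has_fps_expansion_imp_0_eq_fps_nth_0[OF Q] q0 by simp
  have W0: "fps_nth W 0 = 0"
    using has_fps_expansion_imp_0_eq_fps_nth_0[OF Wexp] q0 by (simp add: w_def)
  have "fps_nth Q k = fps_nth (Q - 1) k"
    using k by simp
  also have "\<dots> = (\<Sum>i=0..k. fps_nth W i * fps_nth (Q + 1) (k - i))"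
    by (simp add: eq fps_mult_nth)
  also have "\<dots> = (\<Sum>i\<in>{k}. fps_nth W i * fps_nth (Q + 1) (k - i))"
  proof (rule sum.mono_neutral_right)
    show "\<forall>i\<in>{0..k} - {k}. fps_nth W i * fps_nth (Q + 1) (k - i) = 0"
    proof
      fix i assume "i \<in> {0..k} - {k}"
      then show "fps_nth W i * fps_nth (Q + 1) (k - i) = 0"
        using W0 van[of "k - i"] by (cases "i = 0") auto
    qed
  qed auto
  also have "\<dots> = 2 * fps_nth W k"
    using Q0 by simp
  finally show ?thesis
    using W1 by (simp add: W_def norm_mult)
qed

text \<open>
  Caratheodory's inequality. The average of \<open>p\<close> over the rotations by the \<open>k\<close>-th roots of unity
  still has positive real part; it keeps the coefficient of \<open>z\<^sup>k\<close> and loses those of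
  \<open>z, \<dots>, z\<^sup>k\<^sup>-\<^sup>1\<close>, so the preceding special case applies to it.
\<close>

lemma caratheodory_coeff_bound:
  assumes hol: "p holomorphic_on ball 0 1" and p0: "p 0 = 1"
    and pos: "\<And>z. z \<in> ball 0 1 \<Longrightarrow> Re (p z) > 0"
    and P: "p has_fps_expansion P" and k: "0 < k"
  shows "cmod (fps_nth P k) \<le> 2"
proof -
  define \<omega> where "\<omega> = cis (2 * pi / k)"
  define q where "q z = of_real (1 / k) * (\<Sum>j<k. p (\<omega> ^ j * z))" for z
  define Q where "Q = fps_const (of_real (1 / k)) * (\<Sum>j<k. P oo (fps_const (\<omega> ^ j) * fps_X))"
  have \<omega>1: "cmod (\<omega> ^ j) = 1" for j
    by (simp add: \<omega>_def norm_power)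
  have in_ball: "\<omega> ^ j * z \<in> ball 0 1" if "z \<in> ball 0 1" for j z
    using that \<omega>1[of j] by (simp add: norm_mult)
  have exp: "q has_fps_expansion Q"
    unfolding q_def Q_def
    by (intro fps_expansion_intros has_fps_expansion_compose[OF P, unfolded o_def]) auto
  have Qnth: "fps_nth Q m = of_real (1 / k) * (\<Sum>j<k. (\<omega> ^ m) ^ j) * fps_nth P m" for m
    by (simp add: Q_def fps_sum_nth sum_distrib_right sum_distrib_left)
       (simp add: mult_ac flip: power_mult)
  have "cmod (fps_nth Q k) \<le> 2"
  proof (rule caratheodory_first_coeff[OF _ _ _ exp])
    have "(\<lambda>z. p (\<omega> ^ j * z)) holomorphic_on ball 0 1" for j
      using in_ball
      by (intro holomorphic_on_compose_gen[OF _ hol, unfolded o_def] holomorphic_intros) auto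
    then show "q holomorphic_on ball 0 1"
      unfolding q_def by (intro holomorphic_intros)
    show "q 0 = 1"
      using k by (simp add: q_def p0)
    show "Re (q z) > 0" if "z \<in> ball 0 1" for z
    proof -
      have "0 < (\<Sum>j<k. Re (p (\<omega> ^ j * z)))"
        using k pos[OF in_ball[OF that]] by (intro sum_pos) auto
      then show ?thesis using k by (simp add: q_def)
    qed
    fix m assume m: "0 < m" "m < k"
    have "\<omega> ^ m \<noteq> 1"
    proof -
      have "\<omega> ^ m = cis (real m * (2 * pi / k))"
        by (simp only: \<omega>_def Complex.DeMoivre)
      also have "real m * (2 * pi / k) = 2 * pi * (m / k)"
        by simp
      also have "cis \<dots> \<noteq> 1"
      proof
        assume "cis (2 * pi * (m / k)) = 1"
        then have "cos (2 * pi * (m / k)) = 1"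
          by (simp add: complex_eq_iff)
        then obtain i :: int where "2 * pi * (m / k) = of_int i * 2 * pi"
          using cos_one_2pi_int by auto
        then have "real m = of_int i * real k"
          using k by (simp add: field_simps)
        then have "int m = i * int k"
          by (metis of_int_eq_iff of_int_mult of_int_of_nat_eq)
        with m show False
          by (metis dvd_triv_right int_dvd_int_iff nat_dvd_not_less)
      qed
      finally show ?thesis .
    qed
    moreover have "(\<omega> ^ m) ^ k = 1"
    proof -
      have "(\<omega> ^ m) ^ k = (\<omega> ^ k) ^ m" by (simp add: mult.commute flip: power_mult)
      also have "\<omega> ^ k = 1" using k by (simp add: \<omega>_def Complex.DeMoivre)
      finally show ?thesis by simp
    qed
    ultimately show "fps_nth Q m = 0"
      by (simp add: Qnth geometric_sum)
  qed (use k in auto)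
  moreover have "fps_nth Q k = fps_nth P k"
  proof -
    have "\<omega> ^ k = 1" using k by (simp add: \<omega>_def Complex.DeMoivre)
    then show ?thesis using k by (simp add: Qnth)
  qed
  ultimately show ?thesis by simp
qed

section \<open>The coefficient bound for convex functions of order \<open>\<alpha>\<close>\<close>

text \<open>
  The sharp bound for the modulus of the \<open>n\<close>-th Taylor coefficient of a function in
  \<open>class_K \<alpha>\<close>, for \<open>n \<ge> 1\<close>.
\<close>

definition coeff_bound :: "real \<Rightarrow> nat \<Rightarrow> real" where
  "coeff_bound \<alpha> n = 1 / fact n * (\<Prod>j=2..n. real j - 2 * \<alpha>)"

lemma coeff_bound_1: "coeff_bound \<alpha> (Suc 0) = 1"
  by (simp add: coeff_bound_def)

lemma coeff_bound_Suc_Suc: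
  "(real k + 2) * coeff_bound \<alpha> (Suc (Suc k)) = (real k + 2 - 2 * \<alpha>) * coeff_bound \<alpha> (Suc k)"
proof -
  have "(\<Prod>j=2..Suc (Suc k). real j - 2 * \<alpha>)
      = (\<Prod>j=2..Suc k. real j - 2 * \<alpha>) * (real k + 2 - 2 * \<alpha>)"
    by (subst prod.cl_ivl_Suc) (simp add: algebra_simps)
  moreover have "fact (Suc (Suc k)) = (real k + 2) * fact (Suc k)"
    by (subst fact_Suc) (simp add: algebra_simps)
  ultimately show ?thesis
    unfolding coeff_bound_def by (simp add: mult_ac del: prod.cl_ivl_Suc fact_Suc)
qed

text \<open>
  The numbers \<open>(k + 1) coeff_bound \<alpha> (k + 1)\<close>, which are to bound the coefficients of \<open>h'\<close>, satisfy
  with equality the recursive estimate that Caratheodory's inequality yields for those coefficients.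
\<close>

lemma coeff_bound_sum:
  "real n * ((real n + 1) * coeff_bound \<alpha> (Suc n))
     = 2 * (1 - \<alpha>) * (\<Sum>k<n. (real k + 1) * coeff_bound \<alpha> (Suc k))"
proof (induction n)
  case (Suc n)
  have "real (Suc n) * ((real (Suc n) + 1) * coeff_bound \<alpha> (Suc (Suc n)))
      = (real n + 1) * ((real n + 2) * coeff_bound \<alpha> (Suc (Suc n)))"
    by (simp add: algebra_simps)
  also have "\<dots> = real n * ((real n + 1) * coeff_bound \<alpha> (Suc n))
      + 2 * (1 - \<alpha>) * ((real n + 1) * coeff_bound \<alpha> (Suc n))"
    unfolding coeff_bound_Suc_Suc by (simp add: algebra_simps)
  also have "\<dots> = 2 * (1 - \<alpha>) * (\<Sum>k<Suc n. (real k + 1) * coeff_bound \<alpha> (Suc k))"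
    unfolding Suc by (simp add: algebra_simps)
  finally show ?case .
qed simp

lemma fps_X_mult_deriv_nth:
  fixes D :: "'a :: comm_ring_1 fps"
  shows "fps_nth (fps_X * fps_deriv D) n = of_nat n * fps_nth D n"
  by (cases n) auto

text \<open>
  With \<open>p = (1 + z h'' / h' - \<alpha>) / (1 - \<alpha>)\<close>, a function of positive real part, the equation
  \<open>z h'' = (1 - \<alpha>) h' (p - 1)\<close> expresses \<open>n\<close> times the \<open>n\<close>-th coefficient of \<open>h'\<close> by the earlier
  coefficients and those of \<open>p\<close>.
\<close>

lemma class_K_coeff_bound:
  assumes h: "h \<in> class_K \<alpha>" and \<alpha>: "\<alpha> < 1" and n: "1 \<le> n"
  shows "cmod (fps_nth (fps_expansion h 0) n) \<le> coeff_bound \<alpha> n"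
proof -
  define p where "p z = (1 + z * deriv (deriv h) z / deriv h z - of_real \<alpha>) / of_real (1 - \<alpha>)" for z
  have hol: "h holomorphic_on ball 0 1" and h1: "deriv h 0 = 1"
    and nz: "\<And>z. z \<in> ball 0 1 \<Longrightarrow> deriv h z \<noteq> 0"
    and pos: "\<And>z. z \<in> ball 0 1 \<Longrightarrow> Re (1 + z * deriv (deriv h) z / deriv h z) > \<alpha>"
    using h by (auto simp: class_K_def)
  have hol': "deriv h holomorphic_on ball 0 1"
    by (intro holomorphic_deriv hol) auto
  have holp: "p holomorphic_on ball 0 1"
    unfolding p_def using nz \<alpha> by (intro holomorphic_intros hol hol') auto
  define H D P where "H = fps_expansion h 0" and "D = fps_deriv H" and "P = fps_expansion p 0"
  have H: "h has_fps_expansion H" and P: "p has_fps_expansion P"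
    unfolding H_def P_def by (intro fps_expansion_ball hol holp)+
  then have D: "deriv h has_fps_expansion D"
    unfolding D_def by (intro fps_expansion_intros)
  have D0: "fps_nth D 0 = 1"
    using has_fps_expansion_imp_0_eq_fps_nth_0[OF D] h1 by simp
  have \<alpha>_nz: "1 - complex_of_real \<alpha> \<noteq> 0"
    using \<alpha> by (simp flip: of_real_diff)
  have p0: "p 0 = 1"
    using \<alpha>_nz by (simp add: p_def)
  have P0: "fps_nth P 0 = 1"
    using has_fps_expansion_imp_0_eq_fps_nth_0[OF P] p0 by simp
  have Pk: "cmod (fps_nth P k) \<le> 2" if "0 < k" for k
  proof (rule caratheodory_coeff_bound[OF holp p0 _ P that])
    show "0 < Re (p z)" if "z \<in> ball 0 1" for z
      using pos[OF that] \<alpha> unfolding p_def Re_divide_of_real by simp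
  qed
  have ode: "fps_X * fps_deriv D = fps_const (of_real (1 - \<alpha>)) * (D * (P - 1))"
  proof (rule has_fps_expansion_eq_on_ball)
    show "(\<lambda>z. z * deriv (deriv h) z) has_fps_expansion fps_X * fps_deriv D"
      by (intro fps_expansion_intros D)
    show "(\<lambda>z. of_real (1 - \<alpha>) * (deriv h z * (p z - 1)))
        has_fps_expansion fps_const (of_real (1 - \<alpha>)) * (D * (P - 1))"
      by (intro fps_expansion_intros D P)
    fix z :: complex assume "z \<in> ball 0 1"
    then show "z * deriv (deriv h) z = of_real (1 - \<alpha>) * (deriv h z * (p z - 1))"
      using nz[of z] \<alpha>_nz by (simp add: p_def field_simps)
  qed
  have bound: "cmod (fps_nth D k) \<le> (real k + 1) * coeff_bound \<alpha> (Suc k)" for k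
  proof (induction k rule: less_induct)
    case (less k)
    show ?case
    proof (cases "k = 0")
      case False
      have "real k * cmod (fps_nth D k) = cmod (fps_nth (fps_X * fps_deriv D) k)"
        by (simp only: fps_X_mult_deriv_nth norm_mult norm_of_nat)
      also have "\<dots> = (1 - \<alpha>) * cmod (\<Sum>i=0..k. fps_nth D i * fps_nth (P - 1) (k - i))"
        unfolding ode fps_mult_left_const_nth fps_mult_nth[of D] norm_mult norm_of_real
        using \<alpha> by simp
      also have "(\<Sum>i=0..k. fps_nth D i * fps_nth (P - 1) (k - i))
          = (\<Sum>i<k. fps_nth D i * fps_nth (P - 1) (k - i))"
        using P0 by (intro sum.mono_neutral_right) auto
      also have "cmod \<dots> \<le> (\<Sum>i<k. (real i + 1) * coeff_bound \<alpha> (Suc i) * 2)"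
      proof (intro sum_norm_le)
        fix i assume i: "i \<in> {..<k}"
        have "cmod (fps_nth D i) * cmod (fps_nth P (k - i))
            \<le> (real i + 1) * coeff_bound \<alpha> (Suc i) * 2"
          using i less[of i] Pk[of "k - i"]
          by (intro mult_mono) (auto intro: order_trans[OF norm_ge_zero])
        then show "cmod (fps_nth D i * fps_nth (P - 1) (k - i))
            \<le> (real i + 1) * coeff_bound \<alpha> (Suc i) * 2"
          using i by (simp add: norm_mult)
      qed
      also have "(1 - \<alpha>) * (\<Sum>i<k. (real i + 1) * coeff_bound \<alpha> (Suc i) * 2)
          = real k * ((real k + 1) * coeff_bound \<alpha> (Suc k))"
        unfolding coeff_bound_sum by (simp flip: sum_distrib_right)
      finally show ?thesis
        using False \<alpha> by (simp add: mult_left_mono)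
    qed (simp add: D0 coeff_bound_1)
  qed
  obtain m where m: "n = Suc m" using n by (cases n) auto
  have "cmod (fps_nth D m) = (real m + 1) * cmod (fps_nth H n)"
    unfolding D_def m by (simp add: norm_mult flip: of_nat_Suc)
  with bound[of m] show ?thesis
    by (simp add: m H_def)
qed

section \<open>The decomposition of a harmonic mapping\<close>

lemma dilatation_coeffs:
  assumes hol: "h holomorphic_on ball 0 1" "g holomorphic_on ball 0 1" and h1: "deriv h 0 = 1"
    and dil: "\<And>z. z \<in> ball 0 1 \<Longrightarrow> deriv g z = \<zeta> * z ^ n * deriv h z" and n: "1 \<le> n"
  shows "fps_nth (fps_expansion g 0) n = 0"
    and "fps_nth (fps_expansion g 0) (Suc n) = \<zeta> / of_nat (Suc n)"
proof -
  define H G where "H = fps_expansion h 0" and "G = fps_expansion g 0"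
  have H: "deriv h has_fps_expansion fps_deriv H" and G: "deriv g has_fps_expansion fps_deriv G"
    unfolding H_def G_def by (intro has_fps_expansion_deriv fps_expansion_ball hol)+
  have "fps_deriv G = fps_const \<zeta> * fps_X ^ n * fps_deriv H"
    by (rule has_fps_expansion_eq_on_ball[OF G _ dil]) (intro fps_expansion_intros H)
  then have eq: "fps_nth (fps_deriv G) k
      = \<zeta> * (if k < n then 0 else fps_nth (fps_deriv H) (k - n))" for k
    by (simp add: mult.assoc fps_X_power_mult_nth del: fps_deriv_nth)
  have H0: "fps_nth (fps_deriv H) 0 = 1"
    using has_fps_expansion_imp_0_eq_fps_nth_0[OF H] h1 by simp
  obtain m where m: "n = Suc m" using n by (cases n) auto
  have "of_nat n * fps_nth G n = 0"
    using eq[of m] m by simp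
  then show "fps_nth (fps_expansion g 0) n = 0"
    using n by (simp add: G_def del: of_nat_Suc)
  have "of_nat (Suc n) * fps_nth G (Suc n) = \<zeta>"
    using eq[of n] H0 by simp
  then show "fps_nth (fps_expansion g 0) (Suc n) = \<zeta> / of_nat (Suc n)"
    by (simp add: G_def field_simps del: of_nat_Suc)
qed

lemma holomorphic_eq_cnj_imp_constant:
  assumes u: "u holomorphic_on S" and v: "v holomorphic_on S" and S: "open S" "connected S"
    and eq: "\<And>z. z \<in> S \<Longrightarrow> u z = cnj (v z)"
  shows "u constant_on S"
proof -
  have "deriv u z = 0" if z: "z \<in> S" for z
  proof -
    have "(u has_derivative (\<lambda>t. deriv u z * t)) (at z)"
      using holomorphic_derivI[OF u S(1) z] by (simp add: has_field_derivative_def)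
    moreover have "((\<lambda>z. cnj (v z)) has_derivative (\<lambda>t. cnj (deriv v z * t))) (at z)"
      using holomorphic_derivI[OF v S(1) z]
      by (intro has_derivative_cnj) (simp add: has_field_derivative_def)
    then have "(u has_derivative (\<lambda>t. cnj (deriv v z * t))) (at z)"
      by (rule has_derivative_transform_within_open[OF _ S(1) z]) (simp add: eq)
    ultimately have "(\<lambda>t. deriv u z * t) = (\<lambda>t. cnj (deriv v z * t))"
      by (rule has_derivative_unique)
    \<comment> \<open>The left side is complex linear and the right side conjugate linear in \<open>t\<close>.\<close>
    from fun_cong[OF this, of 1] fun_cong[OF this, of \<i>] show "deriv u z = 0"
      by (simp add: complex_eq_iff)
  qed
  then show ?thesis
    by (intro has_field_derivative_0_imp_constant_on S)
       (metis holomorphic_derivI[OF u S(1)])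
qed

text \<open>
  The functions \<open>h\<close> and \<open>g\<close> are determined by \<open>f\<close> on the disc, so the conditions of
  \<open>class_M\<close>, which are stated for some decomposition, hold for every one.
\<close>

lemma canonical_rep_unique:
  assumes "canonical_rep f h g" "canonical_rep f h' g'" and z: "z \<in> ball 0 1"
  shows "h z = h' z" "g z = g' z"
proof -
  have hol: "h holomorphic_on ball 0 1" "g holomorphic_on ball 0 1"
    "h' holomorphic_on ball 0 1" "g' holomorphic_on ball 0 1"
    and g0: "g 0 = 0" "g' 0 = 0"
    and eq: "\<And>z. z \<in> ball 0 1 \<Longrightarrow> h z + cnj (g z) = h' z + cnj (g' z)"
    using assms by (auto simp: canonical_rep_def)
  have eq': "h z - h' z = cnj (g' z - g z)" if "z \<in> ball 0 1" for z
    using eq[OF that] by (simp add: algebra_simps)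
  have "(\<lambda>z. h z - h' z) constant_on ball 0 1"
    by (rule holomorphic_eq_cnj_imp_constant[OF _ _ _ _ eq']) (intro holomorphic_intros hol | simp)+
  then obtain c where c: "\<And>z. z \<in> ball 0 1 \<Longrightarrow> h z - h' z = c"
    by (auto simp: constant_on_def)
  have "c = 0"
    using c[of 0] eq'[of 0] g0 by simp
  with c[OF z] show "h z = h' z" by simp
  with eq[OF z] show "g z = g' z" by simp
qed

section \<open>The extremal maps\<close>

lemma primitive_on_ball:
  assumes f: "f holomorphic_on ball 0 1"
  obtains F where "F holomorphic_on ball 0 1" "F 0 = 0"
    "\<And>z. z \<in> ball 0 1 \<Longrightarrow> (F has_field_derivative f z) (at z)"
    "\<And>z. z \<in> ball 0 1 \<Longrightarrow> contour_integral (linepath 0 z) f = F z"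
proof -
  obtain F0 where F0: "\<And>z. z \<in> ball 0 1 \<Longrightarrow> (F0 has_field_derivative f z) (at z within ball 0 1)"
    using holomorphic_convex_primitive'[OF _ _ f] by auto
  define F where "F z = F0 z - F0 0" for z
  have F': "(F has_field_derivative f z) (at z)" if "z \<in> ball 0 1" for z
    using F0[OF that] that unfolding F_def
    by (auto intro!: derivative_eq_intros simp: at_within_open[OF that])
  show ?thesis
  proof
    show "F holomorphic_on ball 0 1"
      unfolding holomorphic_on_open[OF open_ball] using F' by blast
    show "F 0 = 0" by (simp add: F_def)
    fix z :: complex assume z: "z \<in> ball 0 1"
    show "(F has_field_derivative f z) (at z)" by (rule F'[OF z])
    have "closed_segment 0 z \<subseteq> ball 0 1"
      using z by (intro closed_segment_subset) auto
    then have "(f has_contour_integral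
        (F0 (pathfinish (linepath 0 z)) - F0 (pathstart (linepath 0 z)))) (linepath 0 z)"
      by (intro contour_integral_primitive[OF F0]) auto
    then show "contour_integral (linepath 0 z) f = F z"
      by (simp add: F_def contour_integral_unique)
  qed
qed

lemma one_minus_not_nonpos_Reals:
  assumes "cmod w < 1" shows "1 - w \<notin> \<real>\<^sub>\<le>\<^sub>0"
  using assms complex_Re_le_cmod[of w] by (auto simp: complex_nonpos_Reals_iff)

lemma Re_extremal_gt:
  assumes w: "cmod w < 1" and "\<alpha> < 1"
  shows "Re (1 + of_real (2 - 2 * \<alpha>) * w / (1 - w)) > \<alpha>"
proof -
  have nz: "1 - w \<noteq> 0" using w by auto
  \<comment> \<open>The map \<open>w \<mapsto> 1 / (1 - w)\<close> takes the unit disc into the half-plane \<open>Re > 1 / 2\<close>.\<close>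
  have "(cmod w)\<^sup>2 < 1"
    using w by (simp add: power_less_one_iff)
  then have "(cmod (1 - w))\<^sup>2 < 2 * Re (1 - w)"
    by (simp add: cmod_power2) (simp add: power2_eq_square algebra_simps)
  then have "1 < 2 * Re (1 / (1 - w))"
    using nz by (simp add: Re_divide' field_simps)
  then have "(1 - \<alpha>) * 1 < (1 - \<alpha>) * (2 * Re (1 / (1 - w)))"
    using assms(2) by (intro mult_strict_left_mono) auto
  moreover have "1 + of_real (2 - 2 * \<alpha>) * w / (1 - w)
      = of_real (2 * \<alpha> - 1) + of_real (2 - 2 * \<alpha>) * (1 / (1 - w))"
    using nz by (simp add: field_simps)
  then have "Re (1 + of_real (2 - 2 * \<alpha>) * w / (1 - w))
      = 2 * \<alpha> - 1 + (2 - 2 * \<alpha>) * Re (1 / (1 - w))"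
    by (simp only: plus_complex.sel times_complex.sel Re_complex_of_real
          Im_complex_of_real mult_zero_left diff_zero)
  ultimately show ?thesis by (simp add: algebra_simps)
qed

text \<open>
  The function \<open>\<phi> = (1 - \<delta> z)\<^sup>-\<^sup>(\<^sup>2\<^sup>-\<^sup>2\<^sup>\<alpha>\<^sup>)\<close> solves \<open>(1 - \<delta> z) \<phi>' = (2 - 2\<alpha>) \<delta> \<phi>\<close>. The resulting
  recursion for its coefficients is, up to powers of \<open>\<delta>\<close>, that of the numbers
  \<open>(k + 1) coeff_bound \<alpha> (k + 1)\<close>.
\<close>

lemma extremal_map_properties:
  fixes \<delta> \<zeta> :: complex
  assumes \<delta>: "cmod \<delta> = 1" and \<zeta>: "cmod \<zeta> \<le> 1" and n: "1 \<le> n" and \<alpha>: "\<alpha> < 1"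
  shows "\<exists>h g. canonical_rep (extremal_map \<alpha> \<delta> \<zeta> n) h g \<and>
    extremal_map \<alpha> \<delta> \<zeta> n \<in> class_M \<alpha> \<zeta> n \<and>
    (\<forall>k. fps_nth (fps_expansion h 0) (Suc k) = \<delta> ^ k * of_real (coeff_bound \<alpha> (Suc k))) \<and>
    fps_nth (fps_expansion g 0) n = 0 \<and>
    fps_nth (fps_expansion g 0) (Suc n) = \<zeta> / of_nat (Suc n)"
proof -
  define c where "c = complex_of_real (2 - 2 * \<alpha>)"
  define \<phi> where "\<phi> t = 1 / (1 - \<delta> * t) powr c" for t
  have less1: "cmod (\<delta> * t) < 1" if "t \<in> ball 0 1" for t
    using that \<delta> by (simp add: norm_mult)
  have nz: "1 - \<delta> * t \<noteq> 0" if "t \<in> ball 0 1" for t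
    using less1[OF that] by auto
  have \<phi>nz: "\<phi> t \<noteq> 0" if "t \<in> ball 0 1" for t
    using nz[OF that] by (simp add: \<phi>_def)
  have \<phi>': "(\<phi> has_field_derivative c * \<delta> * \<phi> t / (1 - \<delta> * t)) (at t)" if "t \<in> ball 0 1" for t
  proof -
    have "((\<lambda>t. (1 - \<delta> * t) powr (- c)) has_field_derivative
        (- c * (1 - \<delta> * t) powr (- c - 1)) * (- \<delta>)) (at t)"
      by (rule DERIV_chain2[where g = "\<lambda>t. 1 - \<delta> * t" and f = "\<lambda>z. z powr (- c)",
              OF has_field_derivative_powr[OF one_minus_not_nonpos_Reals[OF less1[OF that]]]])
         (auto intro!: derivative_eq_intros)
    moreover have "(\<lambda>t. (1 - \<delta> * t) powr (- c)) = \<phi>"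
      by (simp add: \<phi>_def powr_minus_divide fun_eq_iff)
    moreover have "(- c * (1 - \<delta> * t) powr (- c - 1)) * (- \<delta>) = c * \<delta> * \<phi> t / (1 - \<delta> * t)"
      using nz[OF that] by (simp add: powr_diff powr_minus_divide \<phi>_def)
    ultimately show ?thesis by simp
  qed
  have hol\<phi>: "\<phi> holomorphic_on ball 0 1"
    unfolding holomorphic_on_open[OF open_ball] using \<phi>' by blast
  obtain h where h: "h holomorphic_on ball 0 1" "h 0 = 0"
    and h': "\<And>z. z \<in> ball 0 1 \<Longrightarrow> (h has_field_derivative \<phi> z) (at z)"
    and hint: "\<And>z. z \<in> ball 0 1 \<Longrightarrow> contour_integral (linepath 0 z) \<phi> = h z"
    using primitive_on_ball[OF hol\<phi>] by blast
  have "(\<lambda>t. \<zeta> * t ^ n * \<phi> t) holomorphic_on ball 0 1"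
    by (intro holomorphic_intros hol\<phi>)
  then obtain g where g: "g holomorphic_on ball 0 1" "g 0 = 0"
    and g': "\<And>z. z \<in> ball 0 1 \<Longrightarrow> (g has_field_derivative \<zeta> * z ^ n * \<phi> z) (at z)"
    and gint: "\<And>z. z \<in> ball 0 1 \<Longrightarrow> contour_integral (linepath 0 z) (\<lambda>t. \<zeta> * t ^ n * \<phi> t) = g z"
    using primitive_on_ball by blast
  have dh: "deriv h z = \<phi> z" if "z \<in> ball 0 1" for z
    using h'[OF that] by (rule DERIV_imp_deriv)
  have dg: "deriv g z = \<zeta> * z ^ n * deriv h z" if "z \<in> ball 0 1" for z
    using DERIV_imp_deriv[OF g'[OF that]] dh[OF that] by simp
  have ddh: "deriv (deriv h) z = c * \<delta> * \<phi> z / (1 - \<delta> * z)" if z: "z \<in> ball 0 1" for z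
  proof (rule DERIV_imp_deriv)
    show "(deriv h has_field_derivative c * \<delta> * \<phi> z / (1 - \<delta> * z)) (at z)"
      by (rule has_field_derivative_transform_within_open[OF \<phi>'[OF z] _ z]) (auto simp: dh)
  qed
  have dh0: "deriv h 0 = 1"
    by (simp add: dh \<phi>_def)
  have rep: "canonical_rep (extremal_map \<alpha> \<delta> \<zeta> n) h g"
    unfolding canonical_rep_def
  proof (intro conjI ballI h g)
    fix z :: complex assume z: "z \<in> ball 0 1"
    show "extremal_map \<alpha> \<delta> \<zeta> n z = h z + cnj (g z)"
      using hint[OF z] gint[OF z] by (simp add: extremal_map_def \<phi>_def[abs_def] c_def)
  qed
  have hK: "h \<in> class_K \<alpha>"
    unfolding class_K_def
  proof (intro CollectI conjI ballI h dh0)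
    fix z :: complex assume z: "z \<in> ball 0 1"
    show "deriv h z \<noteq> 0" using dh[OF z] \<phi>nz[OF z] by simp
    have "z * deriv (deriv h) z / deriv h z = c * (\<delta> * z) / (1 - \<delta> * z)"
      using \<phi>nz[OF z] by (simp add: dh[OF z] ddh[OF z])
    then show "Re (1 + z * deriv (deriv h) z / deriv h z) > \<alpha>"
      using Re_extremal_gt[OF less1[OF z] \<alpha>] by (simp add: c_def)
  qed
  have lt: "cmod (deriv g z) < cmod (deriv h z)" if z: "z \<in> ball 0 1" for z
  proof -
    have "cmod \<zeta> * cmod z ^ n \<le> 1 * cmod z ^ n"
      using \<zeta> by (intro mult_right_mono) auto
    also have "\<dots> < 1"
      using z n by (simp add: power_less_one_iff)
    finally have "cmod \<zeta> * cmod z ^ n * cmod (deriv h z) < 1 * cmod (deriv h z)"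
      using dh[OF z] \<phi>nz[OF z] by (intro mult_strict_right_mono) auto
    then show ?thesis by (simp add: dg[OF z] norm_mult norm_power)
  qed
  have M: "extremal_map \<alpha> \<delta> \<zeta> n \<in> class_M \<alpha> \<zeta> n"
    using rep hK lt dg h(2) dh0 unfolding class_M_def class_H_def by blast
  define D where "D = fps_deriv (fps_expansion h 0)"
  have D: "deriv h has_fps_expansion D"
    unfolding D_def by (intro has_fps_expansion_deriv fps_expansion_ball h)
  have "fps_deriv D - fps_const \<delta> * (fps_X * fps_deriv D) = fps_const (c * \<delta>) * D"
  proof (rule has_fps_expansion_eq_on_ball)
    show "(\<lambda>z. deriv (deriv h) z - \<delta> * (z * deriv (deriv h) z))
        has_fps_expansion fps_deriv D - fps_const \<delta> * (fps_X * fps_deriv D)"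
      by (intro fps_expansion_intros D)
    show "(\<lambda>z. (c * \<delta>) * deriv h z) has_fps_expansion fps_const (c * \<delta>) * D"
      by (intro fps_expansion_intros D)
    fix z :: complex assume z: "z \<in> ball 0 1"
    have "deriv (deriv h) z - \<delta> * (z * deriv (deriv h) z) = (1 - \<delta> * z) * deriv (deriv h) z"
      by (simp add: algebra_simps)
    then show "deriv (deriv h) z - \<delta> * (z * deriv (deriv h) z) = (c * \<delta>) * deriv h z"
      using nz[OF z] by (simp add: dh[OF z] ddh[OF z])
  qed
  then have "fps_nth (fps_deriv D - fps_const \<delta> * (fps_X * fps_deriv D)) k
      = fps_nth (fps_const (c * \<delta>) * D) k" for k
    by simp
  then have rec: "of_nat (Suc k) * fps_nth D (Suc k) - \<delta> * (of_nat k * fps_nth D k)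
      = c * \<delta> * fps_nth D k" for k
    unfolding fps_sub_nth fps_mult_left_const_nth fps_X_mult_deriv_nth by simp
  have Dk: "fps_nth D k = \<delta> ^ k * of_real ((real k + 1) * coeff_bound \<alpha> (Suc k))" for k
  proof (induction k)
    case 0
    show ?case
      using has_fps_expansion_imp_0_eq_fps_nth_0[OF D] dh0 by (simp add: coeff_bound_1)
  next
    case (Suc k)
    have "of_nat (Suc k) * fps_nth D (Suc k) = \<delta> * of_real (real k + 2 - 2 * \<alpha>) * fps_nth D k"
      using rec[of k] by (simp add: c_def algebra_simps)
    also have "\<dots> = of_nat (Suc k) * (\<delta> ^ Suc k *
        of_real ((real k + 2 - 2 * \<alpha>) * coeff_bound \<alpha> (Suc k)))"
      unfolding Suc by (simp add: algebra_simps)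
    also have "(real k + 2 - 2 * \<alpha>) * coeff_bound \<alpha> (Suc k)
        = (real (Suc k) + 1) * coeff_bound \<alpha> (Suc (Suc k))"
      using coeff_bound_Suc_Suc[of k \<alpha>] by (simp add: algebra_simps)
    finally show ?case
      by (subst (asm) mult_cancel_left) (simp del: of_nat_Suc)
  qed
  show ?thesis
  proof (rule exI[of _ h], rule exI[of _ g], intro conjI allI rep M)
    fix k
    have "of_nat (Suc k) * fps_nth (fps_expansion h 0) (Suc k) = fps_nth D k"
      by (simp add: D_def)
    also have "\<dots> = of_nat (Suc k) * (\<delta> ^ k * of_real (coeff_bound \<alpha> (Suc k)))"
      unfolding Dk by (simp add: algebra_simps)
    finally show "fps_nth (fps_expansion h 0) (Suc k) = \<delta> ^ k * of_real (coeff_bound \<alpha> (Suc k))"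
      by (subst (asm) mult_cancel_left) (simp del: of_nat_Suc)
  qed (rule dilatation_coeffs[OF h(1) g(1) dh0 dg n], assumption)+
qed

section \<open>The Toeplitz determinants\<close>

theorem theorem3p1:
  fixes n :: nat and \<alpha> :: real
  assumes "n \<ge> 1" and "- 1 / 2 \<le> \<alpha>" and "\<alpha> < 1"
  shows
    "(\<forall>\<zeta> f h g. cmod \<zeta> \<le> 1 / (2 * real n - 1) \<longrightarrow> f \<in> class_M \<alpha> \<zeta> n \<longrightarrow> canonical_rep f h g \<longrightarrow>
        (n \<noteq> 1 \<longrightarrow>
          cmod (sym_toeplitz_det 2 n h)
            \<le> (1 / fact n * (\<Prod>j=2..n. real j - 2 * \<alpha>))\<^sup>2
              + (1 / fact (n + 1) * (\<Prod>j=2..n+1. real j - 2 * \<alpha>))\<^sup>2) \<and>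
        cmod (sym_toeplitz_det 2 n g) \<le> 1 / ((2 * real n - 1) * (real n + 1))\<^sup>2) \<and>
     (n \<noteq> 1 \<longrightarrow>
        (\<exists>\<delta> \<zeta> h g. cmod \<delta> = 1 \<and> cmod \<zeta> \<le> 1 / (2 * real n - 1) \<and>
          extremal_map \<alpha> \<delta> \<zeta> n \<in> class_M \<alpha> \<zeta> n \<and>
          canonical_rep (extremal_map \<alpha> \<delta> \<zeta> n) h g \<and>
          cmod (sym_toeplitz_det 2 n h)
            = (1 / fact n * (\<Prod>j=2..n. real j - 2 * \<alpha>))\<^sup>2
              + (1 / fact (n + 1) * (\<Prod>j=2..n+1. real j - 2 * \<alpha>))\<^sup>2)) \<and>
     (\<exists>\<delta> \<zeta> h g. cmod \<delta> = 1 \<and> cmod \<zeta> \<le> 1 / (2 * real n - 1) \<and>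
        extremal_map \<alpha> \<delta> \<zeta> n \<in> class_M \<alpha> \<zeta> n \<and>
        canonical_rep (extremal_map \<alpha> \<delta> \<zeta> n) h g \<and>
        cmod (sym_toeplitz_det 2 n g) = 1 / ((2 * real n - 1) * (real n + 1))\<^sup>2)"
  unfolding coeff_bound_def[symmetric]
proof (intro conjI allI impI)
  have pos: "0 < 2 * real n - 1"
    using assms(1) by simp
  have le1: "1 / (2 * real n - 1) \<le> 1"
    using assms(1) by simp
  {
    fix \<zeta> f h g
    assume \<zeta>: "cmod \<zeta> \<le> 1 / (2 * real n - 1)" and f: "f \<in> class_M \<alpha> \<zeta> n"
      and rep: "canonical_rep f h g"
    obtain h' g' where rep': "canonical_rep f h' g'" and K: "h' \<in> class_K \<alpha>"
      and dil: "\<And>z. z \<in> ball 0 1 \<Longrightarrow> deriv g' z = \<zeta> * z ^ n * deriv h' z"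
      using f by (auto simp: class_M_def)
    have H: "fps_expansion h 0 = fps_expansion h' 0" and G: "fps_expansion g 0 = fps_expansion g' 0"
      by (intro fps_expansion_eq_on_ball canonical_rep_unique[OF rep rep']; assumption)+
    show "cmod (sym_toeplitz_det 2 n h) \<le> (coeff_bound \<alpha> n)\<^sup>2 + (coeff_bound \<alpha> (n + 1))\<^sup>2"
    proof -
      have "cmod (fps_nth (fps_expansion h 0) k) ^ 2 \<le> (coeff_bound \<alpha> k)\<^sup>2" if "1 \<le> k" for k
        unfolding H using class_K_coeff_bound[OF K assms(3) that] by (intro power_mono) auto
      from this[of n] this[of "n + 1"] show ?thesis
        unfolding sym_toeplitz_det_2 using assms(1)
        by (intro order_trans[OF norm_triangle_ineq4] add_mono) (auto simp: norm_power)
    qed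
    have "cmod (sym_toeplitz_det 2 n g) = (cmod \<zeta> / (real n + 1))\<^sup>2"
      using rep' K dil assms(1) dilatation_coeffs[of h' g' \<zeta> n]
      by (simp add: sym_toeplitz_det_2 G canonical_rep_def class_K_def norm_power norm_divide
            flip: of_nat_Suc)
    also have "\<dots> \<le> (1 / (2 * real n - 1) / (real n + 1))\<^sup>2"
      using \<zeta> by (intro power_mono divide_right_mono) auto
    finally show "cmod (sym_toeplitz_det 2 n g) \<le> 1 / ((2 * real n - 1) * (real n + 1))\<^sup>2"
      by (simp add: power_divide)
  }
  show "\<exists>\<delta> \<zeta> h g. cmod \<delta> = 1 \<and> cmod \<zeta> \<le> 1 / (2 * real n - 1) \<and>
      extremal_map \<alpha> \<delta> \<zeta> n \<in> class_M \<alpha> \<zeta> n \<and>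
      canonical_rep (extremal_map \<alpha> \<delta> \<zeta> n) h g \<and>
      cmod (sym_toeplitz_det 2 n h) = (coeff_bound \<alpha> n)\<^sup>2 + (coeff_bound \<alpha> (n + 1))\<^sup>2"
  proof -
    obtain m where m: "n = Suc m" using assms(1) by (cases n) auto
    \<comment> \<open>For \<open>\<delta> = \<i>\<close> the two squares in the determinant are real multiples of \<open>\<i>\<^sup>2\<^sup>(\<^sup>n\<^sup>-\<^sup>1\<^sup>)\<close> with opposite signs.\<close>
    obtain h g where rep: "canonical_rep (extremal_map \<alpha> \<i> 0 n) h g"
      and M: "extremal_map \<alpha> \<i> 0 n \<in> class_M \<alpha> 0 n"
      and hk: "\<And>k. fps_nth (fps_expansion h 0) (Suc k) = \<i> ^ k * of_real (coeff_bound \<alpha> (Suc k))"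
      using extremal_map_properties[of \<i> 0 n \<alpha>] assms by auto
    have "sym_toeplitz_det 2 n h
        = (\<i> ^ m)\<^sup>2 * of_real ((coeff_bound \<alpha> n)\<^sup>2 + (coeff_bound \<alpha> (n + 1))\<^sup>2)"
      using hk[of m] hk[of "Suc m"]
      by (simp add: sym_toeplitz_det_2 m power_mult_distrib algebra_simps)
    then have "cmod (sym_toeplitz_det 2 n h) = (coeff_bound \<alpha> n)\<^sup>2 + (coeff_bound \<alpha> (n + 1))\<^sup>2"
      by (simp only: norm_mult norm_power norm_of_real) simp
    then show ?thesis
      using rep M pos by (intro exI[of _ \<i>] exI[of _ 0] exI[of _ h] exI[of _ g]) simp
  qed
  show "\<exists>\<delta> \<zeta> h g. cmod \<delta> = 1 \<and> cmod \<zeta> \<le> 1 / (2 * real n - 1) \<and>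
      extremal_map \<alpha> \<delta> \<zeta> n \<in> class_M \<alpha> \<zeta> n \<and>
      canonical_rep (extremal_map \<alpha> \<delta> \<zeta> n) h g \<and>
      cmod (sym_toeplitz_det 2 n g) = 1 / ((2 * real n - 1) * (real n + 1))\<^sup>2"
  proof -
    define \<zeta> where "\<zeta> = complex_of_real (1 / (2 * real n - 1))"
    have \<zeta>: "cmod \<zeta> = 1 / (2 * real n - 1)"
      unfolding \<zeta>_def norm_of_real using pos by simp
    obtain h g where rep: "canonical_rep (extremal_map \<alpha> 1 \<zeta> n) h g"
      and M: "extremal_map \<alpha> 1 \<zeta> n \<in> class_M \<alpha> \<zeta> n"
      and g: "fps_nth (fps_expansion g 0) n = 0"
        "fps_nth (fps_expansion g 0) (Suc n) = \<zeta> / of_nat (Suc n)"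
      using extremal_map_properties[of 1 \<zeta> n \<alpha>] assms le1 \<zeta> by auto
    have "cmod (sym_toeplitz_det 2 n g) = (cmod \<zeta> / (real n + 1))\<^sup>2"
      using g by (simp add: sym_toeplitz_det_2 norm_power norm_divide flip: of_nat_Suc)
    then have "cmod (sym_toeplitz_det 2 n g) = 1 / ((2 * real n - 1) * (real n + 1))\<^sup>2"
      unfolding \<zeta> by (simp add: power_divide)
    then show ?thesis
      using rep M \<zeta> by (intro exI[of _ 1] exI[of _ \<zeta>] exI[of _ h] exI[of _ g]) simp
  qed
qed

end
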